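(* Let $0<q\le 1$ and suppose that $\mathcal{A}$ is a proper $q$-Banach subalgebra of $\mathcal{B}(\ell^2(\mathbb{G}))$. Then $\mathcal{A}$ is inverse-closed in $\mathcal{B}(\ell^2(\mathbb{G}))$; that is, if $A\in\mathcal{A}$ and $A^{-1}\in\mathcal{B}(\ell^2(\mathbb{G}))$, then $A^{-1}\in\mathcal{A}$.
   Context: $\mathbb{G}\subset\mathbb{Z}^d$ ($d\ge 1$) is the discrete spatial domain, and $\mathcal{B}(\ell^2(\mathbb{G}))$ is the Banach algebra of bounded linear operators on $\ell^2(\mathbb{G})$, identified with (infinite) matrices indexed by $\mathbb{G}\times\mathbb{G}$. For $0<q\le 1$, a complex vector space $\mathcal{A}$ of matrices is a $q$-Banach space with $q$-norm $\|\cdot\|_{\mathcal{A}}$ if it is complete with respect to the metric $d(A,B)=\|A-B\|_{\mathcal{A}}^q$ and, for all $A,B\in\mathcal{A}$, $\alpha\in\mathbb{C}$: (i) $\|A\|_{\mathcal{A}}\ge 0$, with equality iff $A=0$; (ii) $\|\alpha A\|_{\mathcal{A}}=|\alpha|\,\|A\|_{\mathcal{A}}$; (iii) $\|A+B\|_{\mathcal{A}}^q\le\|A\|_{\mathcal{A}}^q+\|B\|_{\mathcal{A}}^q$. A $q$-Banach space $\mathcal{A}$ is a $q$-Banach algebra if it contains the unit element $I$, with $M:=\|I\|_{\mathcal{A}}<\infty$, and there is a constant $K_0>0$ with (iv) $AB\in\mathcal{A}$ and $\|AB\|_{\mathcal{A}}\le K_0\|A\|_{\mathcal{A}}\|B\|_{\mathcal{A}}$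 for all $A,B\in\mathcal{A}$. A $q$-Banach algebra $\mathcal{A}$ of matrices on $\mathbb{G}$ is proper (a proper $q$-Banach subalgebra of $\mathcal{B}(\ell^2(\mathbb{G}))$) if: (P1) $A^*\in\mathcal{A}$ and $\|A^*\|_{\mathcal{A}}=\|A\|_{\mathcal{A}}$ for all $A\in\mathcal{A}$; (P2) $\mathcal{A}$ is a subalgebra of $\mathcal{B}(\ell^2(\mathbb{G}))$ and $\|A\|_{\mathcal{B}(\ell^2(\mathbb{G}))}\le\|A\|_{\mathcal{A}}$ for all $A\in\mathcal{A}$; (P3) $\mathcal{A}$ is a differential subalgebra of $\mathcal{B}=\mathcal{B}(\ell^2(\mathbb{G}))$ of some order $\theta\in(0,1]$: there is a constant $D>0$ such that for all $A,B\in\mathcal{A}$, $$\|AB\|_{\mathcal{A}}^q\le D\,\|A\|_{\mathcal{A}}^q\|B\|_{\mathcal{A}}^q\left(\Big(\tfrac{\|A\|_{\mathcal{B}}}{\|A\|_{\mathcal{A}}}\Big)^{q\theta}+\Big(\tfrac{\|B\|_{\mathcal{B}}}{\|B\|_{\mathcal{A}}}\Big)^{q\theta}\right)$$ (right side read as $0$ if $A=0$ or $B=0$). *)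

theory Defs
  imports "HOL-Analysis.Analysis" "HOL-Library.Function_Algebras"
begin

text \<open>
  Vectors and matrices over an index set \<open>G\<close> are functions on the whole index type that vanish
  outside \<open>G\<close> (respectively \<open>G \<times> G\<close>), so that equality of functions is equality of vectors
  (respectively matrices). Addition, subtraction and \<open>0\<close> are the pointwise ones; the pointwise
  multiplication of \<^theory>\<open>HOL-Library.Function_Algebras\<close> is never used.
\<close>

definition ell2 :: "'i set \<Rightarrow> ('i \<Rightarrow> complex) set" where
  "ell2 G = {x. (\<forall>i. i \<notin> G \<longrightarrow> x i = 0) \<and> (\<lambda>i. (cmod (x i))\<^sup>2) summable_on G}"

definition ell2_norm :: "'i set \<Rightarrow> ('i \<Rightarrow> complex) \<Rightarrow> real" where
  "ell2_norm G x = sqrt (\<Sum>\<^sub>\<infinity>i\<in>G. (cmod (x i))\<^sup>2)"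

definition bounded_operator :: "'i set \<Rightarrow> (('i \<Rightarrow> complex) \<Rightarrow> ('i \<Rightarrow> complex)) \<Rightarrow> bool" where
  "bounded_operator G T \<longleftrightarrow>
     (\<forall>x\<in>ell2 G. T x \<in> ell2 G) \<and>
     (\<forall>x\<in>ell2 G. \<forall>y\<in>ell2 G. T (x + y) = T x + T y) \<and>
     (\<forall>x\<in>ell2 G. \<forall>c. T (\<lambda>i. c * x i) = (\<lambda>i. c * T x i)) \<and>
     (\<exists>C. \<forall>x\<in>ell2 G. ell2_norm G (T x) \<le> C * ell2_norm G x)"

definition operator_norm :: "'i set \<Rightarrow> (('i \<Rightarrow> complex) \<Rightarrow> ('i \<Rightarrow> complex)) \<Rightarrow> real" where
  "operator_norm G T = (SUP x\<in>{x \<in> ell2 G. ell2_norm G x \<le> 1}. ell2_norm G (T x))"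

type_synonym 'i cmatrix = "'i \<Rightarrow> 'i \<Rightarrow> complex"

definition matrices :: "'i set \<Rightarrow> 'i cmatrix set" where
  "matrices G = {A. \<forall>i j. i \<notin> G \<or> j \<notin> G \<longrightarrow> A i j = 0}"

definition mat_scale :: "complex \<Rightarrow> 'i cmatrix \<Rightarrow> 'i cmatrix" where
  "mat_scale c A = (\<lambda>i j. c * A i j)"

definition mat_one :: "'i set \<Rightarrow> 'i cmatrix" where
  "mat_one G = (\<lambda>i j. if i \<in> G \<and> i = j then 1 else 0)"

definition mat_adjoint :: "'i cmatrix \<Rightarrow> 'i cmatrix" where
  "mat_adjoint A = (\<lambda>i j. cnj (A j i))"

definition mat_mult :: "'i set \<Rightarrow> 'i cmatrix \<Rightarrow> 'i cmatrix \<Rightarrow> 'i cmatrix" where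
  "mat_mult G A B = (\<lambda>i k. \<Sum>\<^sub>\<infinity>j\<in>G. A i j * B j k)"

definition mat_vec :: "'i set \<Rightarrow> 'i cmatrix \<Rightarrow> ('i \<Rightarrow> complex) \<Rightarrow> ('i \<Rightarrow> complex)" where
  "mat_vec G A x = (\<lambda>i. \<Sum>\<^sub>\<infinity>j\<in>G. A i j * x j)"

text \<open>
  The algebra \<open>\<B>(\<ell>\<^sup>2(G))\<close>, identified with matrices: the matrices whose action on \<open>\<ell>\<^sup>2(G)\<close> is given
  by convergent series and is a bounded linear operator. The lemmas following the definitions show
  that every bounded operator arises in this way from the matrix of its entries, and that
  \<open>mat_mult\<close> corresponds to composition.
\<close>

definition bounded_matrices :: "'i set \<Rightarrow> 'i cmatrix set" where
  "bounded_matrices G = {A \<in> matrices G.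
     (\<forall>x\<in>ell2 G. \<forall>i\<in>G. (\<lambda>j. A i j * x j) summable_on G) \<and> bounded_operator G (mat_vec G A)}"

definition mat_opnorm :: "'i set \<Rightarrow> 'i cmatrix \<Rightarrow> real" where
  "mat_opnorm G A = operator_norm G (mat_vec G A)"

definition inverse_closed :: "'i set \<Rightarrow> 'i cmatrix set \<Rightarrow> bool" where
  "inverse_closed G \<A> \<longleftrightarrow>
     (\<forall>A\<in>\<A>. \<forall>B\<in>bounded_matrices G.
        mat_mult G A B = mat_one G \<and> mat_mult G B A = mat_one G \<longrightarrow> B \<in> \<A>)"

definition unit_vec :: "'i \<Rightarrow> 'i \<Rightarrow> complex" where
  "unit_vec j = (\<lambda>i. if i = j then 1 else 0)"

definition operator_matrix :: "'i set \<Rightarrow> (('i \<Rightarrow> complex) \<Rightarrow> ('i \<Rightarrow> complex)) \<Rightarrow> 'i cmatrix" where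
  "operator_matrix G T = (\<lambda>i j. if i \<in> G \<and> j \<in> G then T (unit_vec j) i else 0)"

lemma finite_support_in_ell2:
  assumes "finite F" "F \<subseteq> G" "\<And>i. i \<notin> F \<Longrightarrow> x i = 0"
  shows "x \<in> ell2 G"
proof -
  have "(\<lambda>i. (cmod (x i))\<^sup>2) summable_on F"
    using assms(1) by simp
  also have "?this \<longleftrightarrow> (\<lambda>i. (cmod (x i))\<^sup>2) summable_on G"
    by (rule summable_on_cong_neutral) (use assms in auto)
  finally show ?thesis
    using assms by (auto simp: ell2_def)
qed

lemma unit_vec_in_ell2: "j \<in> G \<Longrightarrow> unit_vec j \<in> ell2 G"
  by (rule finite_support_in_ell2[of "{j}"]) (auto simp: unit_vec_def)

lemma cmod_le_ell2_norm:
  assumes "x \<in> ell2 G"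
  shows "cmod (x i) \<le> ell2_norm G x"
proof (cases "i \<in> G")
  case True
  have "sum (\<lambda>i. (cmod (x i))\<^sup>2) {i} \<le> (\<Sum>\<^sub>\<infinity>i\<in>G. (cmod (x i))\<^sup>2)"
    by (rule finite_sum_le_infsum) (use assms True in \<open>auto simp: ell2_def\<close>)
  then show ?thesis
    unfolding ell2_norm_def by (intro real_le_rsqrt) simp
next
  case False
  then show ?thesis
    using assms by (auto simp: ell2_def ell2_norm_def intro!: infsum_nonneg)
qed

lemma bounded_operator_has_sum:
  assumes T: "bounded_operator G T" and x: "x \<in> ell2 G"
  shows "((\<lambda>j. T (unit_vec j) i * x j) has_sum T x i) G"
proof -
  obtain C where C: "\<And>y. y \<in> ell2 G \<Longrightarrow> ell2_norm G (T y) \<le> C * ell2_norm G y"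
    using T unfolding bounded_operator_def by blast
  define tr where "tr F = (\<lambda>j. if j \<in> F then x j else 0)" for F
  have tr_in: "tr F \<in> ell2 G" if "finite F" "F \<subseteq> G" for F
    by (rule finite_support_in_ell2[OF that]) (simp add: tr_def)
  have T_tr: "T (tr F) i = (\<Sum>j\<in>F. T (unit_vec j) i * x j)" if "finite F" "F \<subseteq> G" for F
    using that
  proof (induction F)
    case empty
    have "T (\<lambda>i. 0 * x i) = (\<lambda>i. 0 * T x i)"
      using T x unfolding bounded_operator_def by blast
    then show ?case
      by (simp add: tr_def fun_eq_iff)
  next
    case (insert a F)
    have e: "unit_vec a \<in> ell2 G"
      using insert by (auto intro: unit_vec_in_ell2)
    have s: "(\<lambda>i. x a * unit_vec a i) \<in> ell2 G"
      by (rule finite_support_in_ell2[of "{a}"]) (use insert in \<open>auto simp: unit_vec_def\<close>)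
    have "tr (insert a F) = (\<lambda>i. x a * unit_vec a i) + tr F"
      using insert.hyps by (auto simp: tr_def unit_vec_def fun_eq_iff)
    moreover have "T ((\<lambda>i. x a * unit_vec a i) + tr F) = T (\<lambda>i. x a * unit_vec a i) + T (tr F)"
      using T s tr_in[of F] insert unfolding bounded_operator_def by blast
    moreover have "T (\<lambda>i. x a * unit_vec a i) = (\<lambda>i. x a * T (unit_vec a) i)"
      using T e unfolding bounded_operator_def by blast
    ultimately have "T (tr (insert a F)) i = x a * T (unit_vec a) i + T (tr F) i"
      by (simp only: plus_fun_apply)
    then show ?case
      using insert by (simp add: mult.commute)
  qed
  have sq: "(\<lambda>i. (cmod (x i))\<^sup>2) summable_on G"
    using x by (simp add: ell2_def)
  define S where "S = (\<Sum>\<^sub>\<infinity>i\<in>G. (cmod (x i))\<^sup>2)"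
  have est: "cmod (T (tr F) i - T x i) \<le> C * sqrt (S - (\<Sum>j\<in>F. (cmod (x j))\<^sup>2))"
    if F: "finite F" "F \<subseteq> G" for F
  proof -
    define y where "y = (\<lambda>j. (-1) * (if j \<in> F then 0 else x j))"
    have sum_y: "((\<lambda>j. (cmod (y j))\<^sup>2) has_sum (S - (\<Sum>j\<in>F. (cmod (x j))\<^sup>2))) G"
    proof -
      have "((\<lambda>i. (cmod (x i))\<^sup>2) has_sum (S - (\<Sum>j\<in>F. (cmod (x j))\<^sup>2))) (G - F)"
        unfolding S_def using sq F by (intro has_sum_Diff) auto
      also have "?this \<longleftrightarrow> ?thesis"
        by (rule has_sum_cong_neutral) (auto simp: y_def)
      finally show ?thesis .
    qed
    have y: "y \<in> ell2 G"
      using sum_y x by (auto simp: ell2_def y_def summable_on_def)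
    have "tr F = x + y"
      by (auto simp: tr_def y_def fun_eq_iff)
    then have "T (tr F) = T x + T y"
      using T x y unfolding bounded_operator_def by metis
    then have "cmod (T (tr F) i - T x i) = cmod (T y i)"
      by simp
    also have "\<dots> \<le> ell2_norm G (T y)"
      using T y by (intro cmod_le_ell2_norm) (auto simp: bounded_operator_def)
    also have "\<dots> \<le> C * ell2_norm G y"
      by (rule C[OF y])
    also have "ell2_norm G y = sqrt (S - (\<Sum>j\<in>F. (cmod (x j))\<^sup>2))"
      using infsumI[OF sum_y] by (simp add: ell2_norm_def)
    finally show ?thesis .
  qed
  have "((\<lambda>F. C * sqrt (S - (\<Sum>j\<in>F. (cmod (x j))\<^sup>2))) \<longlongrightarrow> C * sqrt (S - S))
          (finite_subsets_at_top G)"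
    unfolding S_def by (intro tendsto_intros infsum_tendsto sq)
  then have "((\<lambda>F. C * sqrt (S - (\<Sum>j\<in>F. (cmod (x j))\<^sup>2))) \<longlongrightarrow> 0) (finite_subsets_at_top G)"
    by simp
  then have "((\<lambda>F. T (tr F) i - T x i) \<longlongrightarrow> 0) (finite_subsets_at_top G)"
    by (rule Lim_null_comparison[rotated])
       (use est in \<open>auto intro: eventually_finite_subsets_at_top_weakI\<close>)
  then have "((\<lambda>F. T (tr F) i) \<longlongrightarrow> T x i) (finite_subsets_at_top G)"
    by (simp add: LIM_zero_iff)
  moreover have "\<forall>\<^sub>F F in finite_subsets_at_top G. T (tr F) i = (\<Sum>j\<in>F. T (unit_vec j) i * x j)"
    using T_tr by (auto intro: eventually_finite_subsets_at_top_weakI)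
  ultimately show ?thesis
    unfolding has_sum_def by (rule Lim_transform_eventually)
qed

lemma mat_vec_operator_matrix:
  assumes "bounded_operator G T" "x \<in> ell2 G"
  shows "mat_vec G (operator_matrix G T) x = T x"
proof
  fix i
  show "mat_vec G (operator_matrix G T) x i = T x i"
  proof (cases "i \<in> G")
    case True
    have "((\<lambda>j. operator_matrix G T i j * x j) has_sum T x i) G \<longleftrightarrow>
          ((\<lambda>j. T (unit_vec j) i * x j) has_sum T x i) G"
      by (rule has_sum_cong) (simp add: operator_matrix_def True)
    then show ?thesis
      using bounded_operator_has_sum[OF assms, of i] by (simp add: mat_vec_def infsumI)
  next
    case False
    then show ?thesis
      using assms by (auto simp: mat_vec_def operator_matrix_def bounded_operator_def ell2_def)
  qed
qed

lemma ell2_add_scale: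
  assumes "x \<in> ell2 G"
  shows "(\<lambda>i. c * x i) \<in> ell2 G" and "y \<in> ell2 G \<Longrightarrow> x + y \<in> ell2 G"
proof -
  show "(\<lambda>i. c * x i) \<in> ell2 G"
    using assms by (auto simp: ell2_def norm_mult power_mult_distrib intro: summable_on_cmult_right)
next
  assume y: "y \<in> ell2 G"
  have "(\<lambda>i. 2 * (cmod (x i))\<^sup>2 + 2 * (cmod (y i))\<^sup>2) summable_on G"
    using assms y by (auto simp: ell2_def intro!: summable_on_add summable_on_cmult_right)
  then have "(\<lambda>i. (cmod (x i + y i))\<^sup>2) summable_on G"
  proof (rule summable_on_comparison_test)
    fix i
    have "(cmod (x i + y i))\<^sup>2 \<le> (cmod (x i) + cmod (y i))\<^sup>2"
      by (intro power_mono norm_triangle_ineq) auto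
    also have "\<dots> \<le> 2 * (cmod (x i))\<^sup>2 + 2 * (cmod (y i))\<^sup>2"
      using zero_le_power2[of "cmod (x i) - cmod (y i)"] by (simp add: power2_eq_square algebra_simps)
    finally show "(cmod (x i + y i))\<^sup>2 \<le> 2 * (cmod (x i))\<^sup>2 + 2 * (cmod (y i))\<^sup>2" .
  qed auto
  then show "x + y \<in> ell2 G"
    using assms y by (auto simp: ell2_def)
qed

lemma bounded_operator_cong:
  assumes "bounded_operator G T" "\<And>x. x \<in> ell2 G \<Longrightarrow> S x = T x"
  shows "bounded_operator G S"
  using assms(1) unfolding bounded_operator_def by (simp add: assms(2) ell2_add_scale)

lemma operator_matrix_in_bounded_matrices:
  assumes T: "bounded_operator G T"
  shows "operator_matrix G T \<in> bounded_matrices G"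
proof -
  have "(\<lambda>j. operator_matrix G T i j * x j) summable_on G" if "x \<in> ell2 G" "i \<in> G" for x i
  proof -
    have "(\<lambda>j. T (unit_vec j) i * x j) summable_on G"
      using bounded_operator_has_sum[OF T that(1)] by (auto simp: summable_on_def)
    also have "?this \<longleftrightarrow> ?thesis"
      by (rule summable_on_cong) (simp add: operator_matrix_def that)
    finally show ?thesis .
  qed
  moreover have "bounded_operator G (mat_vec G (operator_matrix G T))"
    by (rule bounded_operator_cong[OF T mat_vec_operator_matrix[OF T]])
  ultimately show ?thesis
    by (auto simp: bounded_matrices_def matrices_def operator_matrix_def)
qed

lemma mat_vec_unit_vec:
  assumes "j \<in> G"
  shows "mat_vec G A (unit_vec j) i = A i j"
proof -
  have "mat_vec G A (unit_vec j) i = (\<Sum>\<^sub>\<infinity>k\<in>{j}. A i k * unit_vec j k)"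
    unfolding mat_vec_def by (rule infsum_cong_neutral) (use assms in \<open>auto simp: unit_vec_def\<close>)
  then show ?thesis
    by (simp add: unit_vec_def)
qed

lemma operator_matrix_mat_vec:
  assumes "A \<in> bounded_matrices G"
  shows "operator_matrix G (mat_vec G A) = A"
  using assms
  by (auto simp: operator_matrix_def mat_vec_unit_vec bounded_matrices_def matrices_def fun_eq_iff)

lemma bounded_operator_comp:
  assumes "bounded_operator G S" "bounded_operator G T"
  shows "bounded_operator G (S \<circ> T)"
proof -
  obtain C where C: "\<And>x. x \<in> ell2 G \<Longrightarrow> ell2_norm G (S x) \<le> C * ell2_norm G x"
    using assms(1) unfolding bounded_operator_def by blast
  obtain D where D: "\<And>x. x \<in> ell2 G \<Longrightarrow> ell2_norm G (T x) \<le> D * ell2_norm G x"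
    using assms(2) unfolding bounded_operator_def by blast
  have nonneg: "0 \<le> ell2_norm G x" for x :: "'a \<Rightarrow> complex"
    by (simp add: ell2_norm_def infsum_nonneg)
  have "ell2_norm G (S (T x)) \<le> (\<bar>C\<bar> * D) * ell2_norm G x" if x: "x \<in> ell2 G" for x
  proof -
    have "ell2_norm G (S (T x)) \<le> C * ell2_norm G (T x)"
      using assms(2) x by (intro C) (simp add: bounded_operator_def)
    also have "\<dots> \<le> \<bar>C\<bar> * ell2_norm G (T x)"
      using nonneg by (intro mult_right_mono) auto
    also have "\<dots> \<le> \<bar>C\<bar> * (D * ell2_norm G x)"
      using D[OF x] by (intro mult_left_mono) auto
    finally show ?thesis by (simp add: mult.assoc)
  qed
  then show ?thesis
    using assms unfolding bounded_operator_def comp_def by (auto intro!: exI[of _ "\<bar>C\<bar> * D"])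
qed

lemma mat_mult_eq_operator_matrix:
  assumes A: "A \<in> bounded_matrices G" and B: "B \<in> bounded_matrices G"
  shows "mat_mult G A B = operator_matrix G (mat_vec G A \<circ> mat_vec G B)"
proof (intro ext)
  fix i k
  show "mat_mult G A B i k = operator_matrix G (mat_vec G A \<circ> mat_vec G B) i k"
  proof (cases "i \<in> G \<and> k \<in> G")
    case True
    then have "mat_vec G B (unit_vec k) = (\<lambda>j. B j k)"
      by (simp add: mat_vec_unit_vec fun_eq_iff)
    then show ?thesis
      using True by (simp add: operator_matrix_def mat_mult_def mat_vec_def)
  next
    case False
    then have "A i j * B j k = 0" for j
      using A B False by (auto simp: bounded_matrices_def matrices_def)
    then have "mat_mult G A B i k = 0"
      unfolding mat_mult_def by (intro infsum_0) blast
    then show ?thesis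
      using False by (auto simp: operator_matrix_def)
  qed
qed

lemma mat_mult_bounded_matrices:
  assumes "A \<in> bounded_matrices G" "B \<in> bounded_matrices G"
  shows "mat_mult G A B \<in> bounded_matrices G"
    and "x \<in> ell2 G \<Longrightarrow> mat_vec G (mat_mult G A B) x = mat_vec G A (mat_vec G B x)"
proof -
  have "bounded_operator G (mat_vec G A \<circ> mat_vec G B)"
    using assms by (intro bounded_operator_comp) (auto simp: bounded_matrices_def)
  then show "mat_mult G A B \<in> bounded_matrices G"
    and "x \<in> ell2 G \<Longrightarrow> mat_vec G (mat_mult G A B) x = mat_vec G A (mat_vec G B x)"
    by (simp_all add: mat_mult_eq_operator_matrix[OF assms] operator_matrix_in_bounded_matrices
        mat_vec_operator_matrix)
qed

locale q_normed_space =
  fixes G :: "'i set" and q :: real and \<A> :: "'i cmatrix set" and nrm :: "'i cmatrix \<Rightarrow> real"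
  assumes q_pos: "0 < q" and q_le_1: "q \<le> 1"
    and subset_matrices: "\<A> \<subseteq> matrices G"
    and zero_mem: "0 \<in> \<A>"
    and add_mem: "A \<in> \<A> \<Longrightarrow> B \<in> \<A> \<Longrightarrow> A + B \<in> \<A>"
    and scale_mem: "A \<in> \<A> \<Longrightarrow> mat_scale c A \<in> \<A>"
    and nrm_nonneg: "A \<in> \<A> \<Longrightarrow> 0 \<le> nrm A"
    and nrm_eq_0_iff: "A \<in> \<A> \<Longrightarrow> nrm A = 0 \<longleftrightarrow> A = 0"
    and nrm_scale: "A \<in> \<A> \<Longrightarrow> nrm (mat_scale c A) = cmod c * nrm A"
    and nrm_add: "A \<in> \<A> \<Longrightarrow> B \<in> \<A> \<Longrightarrow> nrm (A + B) powr q \<le> nrm A powr q + nrm B powr q"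
begin

text \<open>
  The locale \<^locale>\<open>Metric_space\<close> wants a distance that is nonnegative and symmetric on the
  whole type, while nothing is assumed about \<open>nrm\<close> outside \<open>\<A>\<close>; hence the value \<open>0\<close> there.
\<close>

definition qdist :: "'i cmatrix \<Rightarrow> 'i cmatrix \<Rightarrow> real" where
  "qdist A B = (if A \<in> \<A> \<and> B \<in> \<A> then nrm (A - B) powr q else 0)"

lemma minus_mem:
  assumes "A \<in> \<A>" "B \<in> \<A>"
  shows "A - B \<in> \<A>"
proof -
  have "A - B = A + mat_scale (-1) B"
    by (simp add: mat_scale_def fun_eq_iff)
  then show ?thesis
    using add_mem[OF assms(1) scale_mem[OF assms(2)]] by metis
qed

lemma nrm_minus_commute:
  assumes "A \<in> \<A>" "B \<in> \<A>"
  shows "nrm (A - B) = nrm (B - A)"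
proof -
  have "A - B = mat_scale (-1) (B - A)"
    by (simp add: mat_scale_def fun_eq_iff)
  then show ?thesis
    using nrm_scale[OF minus_mem[OF assms(2,1)], of "-1"] by simp
qed

sublocale Metric_space \<A> qdist
proof
  show "0 \<le> qdist A B" for A B
    by (simp add: qdist_def)
  show "qdist A B = qdist B A" for A B
    using nrm_minus_commute[of A B] by (simp add: qdist_def)
  show "qdist A B = 0 \<longleftrightarrow> A = B" if "A \<in> \<A>" "B \<in> \<A>" for A B
    using that nrm_eq_0_iff[OF minus_mem[OF that]] by (simp add: qdist_def)
  show "qdist A C \<le> qdist A B + qdist B C" if "A \<in> \<A>" "B \<in> \<A>" "C \<in> \<A>" for A B C
    using nrm_add[OF minus_mem[OF that(1,2)] minus_mem[OF that(2,3)]] that by (simp add: qdist_def)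
qed

end

locale q_banach_space = q_normed_space +
  assumes complete: "mcomplete"

text \<open>
  The product of two arbitrary infinite matrices need not be given by convergent series; for the
  proper subalgebras below it is, since their elements lie in \<^const>\<open>bounded_matrices\<close>.
\<close>

locale q_banach_algebra = q_banach_space +
  assumes one_mem: "mat_one G \<in> \<A>"
    and mult_mem: "A \<in> \<A> \<Longrightarrow> B \<in> \<A> \<Longrightarrow> mat_mult G A B \<in> \<A>"
    and nrm_mult: "\<exists>K\<^sub>0>0. \<forall>A\<in>\<A>. \<forall>B\<in>\<A>. nrm (mat_mult G A B) \<le> K\<^sub>0 * nrm A * nrm B"

text \<open>
  In the assumption \<open>differential\<close> division by zero does no harm: if \<open>A = 0\<close> or \<open>B = 0\<close>, then the factor
  \<open>nrm A powr q * nrm B powr q\<close> vanishes, so that the right-hand side is \<open>0\<close>.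
\<close>

locale proper_q_banach_subalgebra = q_banach_algebra +
  assumes adjoint_mem: "A \<in> \<A> \<Longrightarrow> mat_adjoint A \<in> \<A>"
    and nrm_adjoint: "A \<in> \<A> \<Longrightarrow> nrm (mat_adjoint A) = nrm A"
    and subset_bounded: "\<A> \<subseteq> bounded_matrices G"
    and opnorm_le_nrm: "A \<in> \<A> \<Longrightarrow> mat_opnorm G A \<le> nrm A"
    and differential:
      "\<exists>\<theta>>0. \<theta> \<le> 1 \<and> (\<exists>D>0. \<forall>A\<in>\<A>. \<forall>B\<in>\<A>.
         nrm (mat_mult G A B) powr q \<le>
           D * nrm A powr q * nrm B powr q *
             ((mat_opnorm G A / nrm A) powr (q * \<theta>) + (mat_opnorm G B / nrm B) powr (q * \<theta>)))"

end

theory Submission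
  imports Defs
begin

text \<open>
  Since \<open>A\<close> is bounded below on \<open>\<ell>\<^sup>2(G)\<close>, the operator norm of \<open>R = I - c A\<^sup>* A\<close> is smaller than \<open>1\<close>
  for a suitable \<open>c > 0\<close>. For \<open>s k\<close> the \<open>q\<close>-th power of the norm of \<open>R\<close> to the \<open>2\<^sup>k\<close> in \<open>\<A>\<close>, and
  \<open>r < 1\<close> a bound for the operator norm of \<open>R\<close>, (P3) gives
  \<open>s (k + 1) \<le> 2 D (s k)\<^sup>2\<^sup>-\<^sup>\<theta> r\<^sup>q\<^sup>\<theta>\<^sup>n\<close> with \<open>n = 2\<^sup>k\<close>. As \<open>2 - \<theta> < 2\<close>, the second factor wins and
  \<open>s\<close> tends to \<open>0\<close>. Hence some power of \<open>R\<close> is small in \<open>\<A>\<close>, the Neumann series of \<open>R\<close> converges in \<open>\<A>\<close> to a left inverse \<open>S\<close> of \<open>c A\<^sup>* A\<close>,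
  and the inverse of \<open>A\<close> is \<open>c S A\<^sup>*\<close>.
\<close>

section \<open>Real recursions, summability and Cauchy sequences\<close>

lemma squaring_recursion_tendsto_0:
  fixes s :: "nat \<Rightarrow> real"
  assumes \<tau>: "0 < \<tau>" "\<tau> < 1" and \<theta>: "0 < \<theta>" "\<theta> \<le> 1" and D: "0 < D"
    and nonneg: "\<And>k. 0 \<le> s k"
    and step: "\<And>k. s (Suc k) \<le> D * s k powr (2 - \<theta>) * \<tau> powr (\<theta> * 2 ^ k)"
  shows "s \<longlonglongrightarrow> 0"
proof -
  \<comment> \<open>\<open>y k = s k / \<tau> ^ 2 ^ k\<close> satisfies \<open>y (Suc k) \<le> D * y k powr (2 - \<theta>)\<close>; the gap between \<open>2 - \<theta>\<close> and \<open>\<beta>\<close> absorbs \<open>D\<close>.\<close>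
  define \<beta> where "\<beta> = 2 - \<theta> / 2"
  \<comment> \<open>The three entries keep \<open>C\<close> at least 1, start the induction, and
    give \<open>D \<le> C powr (\<theta> / 2)\<close>.\<close>
  define C where "C = Max {1, s 0 / \<tau>, D powr (2 / \<theta>)}"
  have C: "1 \<le> C" "s 0 / \<tau> \<le> C" "D powr (2 / \<theta>) \<le> C"
    by (auto simp: C_def)
  have \<beta>: "1 \<le> \<beta>" "0 \<le> \<beta> / 2" "\<beta> / 2 < 1"
    using \<theta> by (auto simp: \<beta>_def)
  have D_le: "D \<le> C powr (\<theta> / 2 * \<beta> ^ k)" for k
  proof -
    have "D = (D powr (2 / \<theta>)) powr (\<theta> / 2)"
      using D \<theta> by (simp add: powr_powr)
    also have "\<dots> \<le> C powr (\<theta> / 2)"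
      using C \<theta> by (intro powr_mono2) auto
    also have "\<dots> \<le> C powr (\<theta> / 2 * \<beta> ^ k)"
      using C \<theta> one_le_power[OF \<beta>(1), of k] by (intro powr_mono) auto
    finally show ?thesis .
  qed
  have bound: "s k \<le> C powr (\<beta> ^ k) * \<tau> powr (2 ^ k)" for k
  proof (induction k)
    case 0
    then show ?case
      using C \<tau> by (simp add: field_simps)
  next
    case (Suc k)
    have "s (Suc k) \<le> D * s k powr (2 - \<theta>) * \<tau> powr (\<theta> * 2 ^ k)"
      by (rule step)
    also have "\<dots> \<le> C powr (\<theta> / 2 * \<beta> ^ k) * (C powr (\<beta> ^ k) * \<tau> powr (2 ^ k)) powr (2 - \<theta>)
        * \<tau> powr (\<theta> * 2 ^ k)"
      using D_le Suc nonneg \<theta> \<tau> by (intro mult_mono powr_mono2) auto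
    also have "\<dots> = C powr (\<theta> / 2 * \<beta> ^ k + \<beta> ^ k * (2 - \<theta>)) * \<tau> powr (2 ^ k * (2 - \<theta>) + \<theta> * 2 ^ k)"
      using C \<tau> by (simp add: powr_mult powr_powr powr_add)
    also have "\<theta> / 2 * \<beta> ^ k + \<beta> ^ k * (2 - \<theta>) = \<beta> ^ Suc k"
      by (simp add: \<beta>_def field_simps)
    also have "2 ^ k * (2 - \<theta>) + \<theta> * 2 ^ k = 2 ^ Suc k"
      by (simp add: algebra_simps)
    finally show ?case .
  qed
  \<comment> \<open>The logarithm of the bound is
    \<open>2 ^ k * ((\<beta> / 2) ^ k * ln C + ln \<tau>)\<close>. Since \<open>\<beta> < 2\<close>,
    the first summand eventually uses up less than half of \<open>- ln \<tau>\<close>.\<close>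
  have "(\<lambda>k. (\<beta> / 2) ^ k * ln C) \<longlonglongrightarrow> 0"
    using \<beta> by (intro tendsto_mult_left_zero LIMSEQ_realpow_zero)
  then have "\<forall>\<^sub>F k in sequentially. (\<beta> / 2) ^ k * ln C < - ln \<tau> / 2"
    using \<tau> by (intro order_tendstoD) auto
  then have "\<forall>\<^sub>F k in sequentially. norm (s k) \<le> sqrt \<tau> ^ k"
  proof eventually_elim
    case (elim k)
    have "\<beta> ^ k * ln C = 2 ^ k * ((\<beta> / 2) ^ k * ln C)"
      by (simp add: power_divide)
    also have "\<dots> \<le> 2 ^ k * (- ln \<tau> / 2)"
      using elim by (intro mult_left_mono) auto
    finally have "\<beta> ^ k * ln C + 2 ^ k * ln \<tau> \<le> 2 ^ k * (ln \<tau> / 2)"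
      by (simp add: field_simps)
    \<comment> \<open>As \<open>ln \<tau>\<close> is negative, replacing \<open>2 ^ k\<close> by
      \<open>k\<close> weakens the bound to a geometric sequence.\<close>
    also have "\<dots> \<le> real k * (ln \<tau> / 2)"
      using \<tau> less_exp[of k] of_nat_mono[of k "2 ^ k", where 'a = real]
      by (intro mult_right_mono_neg) auto
    finally have "exp (\<beta> ^ k * ln C + 2 ^ k * ln \<tau>) \<le> exp (real k * (ln \<tau> / 2))"
      by simp
    also have "\<dots> = sqrt \<tau> ^ k"
      using \<tau> by (simp add: exp_of_nat_mult ln_sqrt[symmetric])
    also have "exp (\<beta> ^ k * ln C + 2 ^ k * ln \<tau>) = C powr (\<beta> ^ k) * \<tau> powr (2 ^ k)"
      using C \<tau> by (simp add: powr_def exp_add)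
    finally show ?case
      using bound[of k] nonneg[of k] by simp
  qed
  moreover have "(\<lambda>k. sqrt \<tau> ^ k) \<longlonglongrightarrow> 0"
    using \<tau> by (intro LIMSEQ_realpow_zero) auto
  ultimately show ?thesis
    by (rule Lim_null_comparison)
qed

text \<open>A partial sum is at most its first \<open>N\<close> terms plus \<open>\<kappa>\<close>
  times itself; solving for it bounds all partial sums at once. This turns one small power of a
  matrix into summability over all powers.\<close>

lemma summable_if_shift_contracts:
  fixes a :: "nat \<Rightarrow> real"
  assumes "\<And>n. 0 \<le> a n" "\<kappa> < 1" "\<And>n. a (n + N) \<le> \<kappa> * a n"
  shows "summable a"
proof (rule summableI_nonneg_bounded)
  fix m
  have "sum a {..<m} \<le> sum a {..<m + N}"
    using assms(1) by (intro sum_mono2) auto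
  also have "\<dots> = sum a {..<N} + (\<Sum>n<m. a (n + N))"
    by (induction m) auto
  also have "\<dots> \<le> sum a {..<N} + \<kappa> * sum a {..<m}"
    using assms(3) by (auto simp: sum_distrib_left intro: sum_mono)
  finally show "sum a {..<m} \<le> sum a {..<N} / (1 - \<kappa>)"
    using assms(2) by (simp add: field_simps)
qed (use assms in auto)

text \<open>The triangle inequality bounds distances along the sequence by differences of the
  partial sums \<open>P\<close>, which form a Cauchy sequence of reals.\<close>

lemma (in Metric_space) MCauchy_if_summable:
  assumes M: "range \<sigma> \<subseteq> M" and sm: "summable (\<lambda>n. d (\<sigma> n) (\<sigma> (Suc n)))"
  shows "MCauchy \<sigma>"
proof -
  define P where "P n = (\<Sum>k<n. d (\<sigma> k) (\<sigma> (Suc k)))" for n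
  have dist: "d (\<sigma> m) (\<sigma> (m + k)) \<le> P (m + k) - P m" for m k
  proof (induction k)
    case (Suc k)
    have "d (\<sigma> m) (\<sigma> (m + Suc k)) \<le> d (\<sigma> m) (\<sigma> (m + k)) + d (\<sigma> (m + k)) (\<sigma> (m + Suc k))"
      using M by (intro triangle) auto
    with Suc show ?case
      by (simp add: P_def)
  qed (use M in \<open>auto simp: P_def image_subset_iff\<close>)
  have "Cauchy P"
    unfolding P_def using sm by (simp add: Cauchy_convergent_iff summable_iff_convergent)
  moreover have "d (\<sigma> m) (\<sigma> n) \<le> \<bar>P m - P n\<bar>" for m n
  proof (cases "m \<le> n")
    case True
    then show ?thesis using dist[of m "n - m"] by simp
  next
    case False
    then show ?thesis using dist[of n "m - n"] by (simp add: commute)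
  qed
  ultimately show ?thesis
    using M unfolding MCauchy_def Cauchy_def dist_real_def by (meson le_less_trans)
qed

section \<open>Norm and inner product of square-summable vectors\<close>

lemma ell2_norm_nonneg [simp]: "0 \<le> ell2_norm G x"
  by (simp add: ell2_norm_def infsum_nonneg)

lemma ell2_norm_has_sum:
  "x \<in> ell2 G \<Longrightarrow> ((\<lambda>i. (cmod (x i))\<^sup>2) has_sum (ell2_norm G x)\<^sup>2) G"
  by (simp add: ell2_norm_def ell2_def infsum_nonneg)

lemma ell2_norm_scale: "ell2_norm G (\<lambda>i. c * x i) = cmod c * ell2_norm G x"
  by (simp add: ell2_norm_def norm_mult power_mult_distrib infsum_cmult_right' real_sqrt_mult)

lemma zero_in_ell2: "(\<lambda>i. 0) \<in> ell2 G"
  by (simp add: ell2_def)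

lemma ell2_norm_zero [simp]: "ell2_norm G (\<lambda>i. 0) = 0"
  by (simp add: ell2_norm_def)

lemma ell2_norm_single:
  assumes "g \<in> G"
  shows "ell2_norm G (\<lambda>i. if i = g then c else 0) = cmod c"
proof -
  have "(\<Sum>\<^sub>\<infinity>i\<in>G. (cmod (if i = g then c else 0))\<^sup>2) = (\<Sum>\<^sub>\<infinity>i\<in>{g}. (cmod (if i = g then c else 0))\<^sup>2)"
    by (rule infsum_cong_neutral) (use assms in auto)
  then show ?thesis
    by (simp add: ell2_norm_def)
qed

text \<open>The finite Cauchy-Schwarz inequality bounds every finite partial sum of absolute values
  by the same constant, which yields both absolute summability and the estimate.\<close>

lemma ell2_product:
  assumes x: "x \<in> ell2 G" and y: "y \<in> ell2 G"
  shows ell2_product_summable: "(\<lambda>i. cnj (y i) * x i) summable_on G"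
    and ell2_Cauchy_Schwarz: "cmod (\<Sum>\<^sub>\<infinity>i\<in>G. cnj (y i) * x i) \<le> ell2_norm G y * ell2_norm G x"
proof -
  have L2: "L2_set (\<lambda>i. cmod (z i)) F \<le> ell2_norm G z" if "finite F" "F \<subseteq> G" "z \<in> ell2 G" for F z
    unfolding L2_set_def ell2_norm_def
    using that by (intro real_sqrt_le_mono finite_sum_le_infsum) (auto simp: ell2_def)
  have le: "(\<Sum>i\<in>F. cmod (cnj (y i) * x i)) \<le> ell2_norm G y * ell2_norm G x"
    if "finite F" "F \<subseteq> G" for F
  proof -
    have "(\<Sum>i\<in>F. cmod (cnj (y i) * x i)) = (\<Sum>i\<in>F. \<bar>cmod (y i)\<bar> * \<bar>cmod (x i)\<bar>)"
      by (simp add: norm_mult)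
    also have "\<dots> \<le> L2_set (\<lambda>i. cmod (y i)) F * L2_set (\<lambda>i. cmod (x i)) F"
      by (rule L2_set_mult_ineq)
    also have "\<dots> \<le> ell2_norm G y * ell2_norm G x"
      using L2 that x y by (intro mult_mono) auto
    finally show ?thesis .
  qed
  have sm: "(\<lambda>i. cmod (cnj (y i) * x i)) summable_on G"
    by (rule nonneg_bounded_partial_sums_imp_summable_on[where C = "ell2_norm G y * ell2_norm G x"])
       (use le in \<open>auto intro: eventually_finite_subsets_at_top_weakI\<close>)
  then show "(\<lambda>i. cnj (y i) * x i) summable_on G"
    by (rule abs_summable_summable)
  have "cmod (\<Sum>\<^sub>\<infinity>i\<in>G. cnj (y i) * x i) \<le> (\<Sum>\<^sub>\<infinity>i\<in>G. cmod (cnj (y i) * x i))"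
    using sm by (rule norm_infsum_bound)
  also have "\<dots> \<le> ell2_norm G y * ell2_norm G x"
    using sm le by (rule infsum_le_finite_sums)
  finally show "cmod (\<Sum>\<^sub>\<infinity>i\<in>G. cnj (y i) * x i) \<le> ell2_norm G y * ell2_norm G x" .
qed

section \<open>Bounded matrices as operators\<close>

lemma bounded_matrix_mat_vec:
  assumes "A \<in> bounded_matrices G" "x \<in> ell2 G"
  shows mat_vec_in_ell2: "mat_vec G A x \<in> ell2 G"
    and mat_vec_scale_vec: "mat_vec G A (\<lambda>i. c * x i) = (\<lambda>i. c * mat_vec G A x i)"
    and mat_vec_summable: "(\<lambda>j. A i j * x j) summable_on G"
proof -
  show "mat_vec G A x \<in> ell2 G" "mat_vec G A (\<lambda>i. c * x i) = (\<lambda>i. c * mat_vec G A x i)"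
    using assms by (auto simp: bounded_matrices_def bounded_operator_def)
  show "(\<lambda>j. A i j * x j) summable_on G"
    using assms by (cases "i \<in> G") (auto simp: bounded_matrices_def matrices_def)
qed

lemma mat_vec_add_vec:
  "A \<in> bounded_matrices G \<Longrightarrow> x \<in> ell2 G \<Longrightarrow> y \<in> ell2 G \<Longrightarrow>
    mat_vec G A (x + y) = mat_vec G A x + mat_vec G A y"
  by (simp add: bounded_matrices_def bounded_operator_def)

lemma mat_vec_add:
  assumes "A \<in> bounded_matrices G" "B \<in> bounded_matrices G" "x \<in> ell2 G"
  shows "mat_vec G (A + B) x = mat_vec G A x + mat_vec G B x"
  unfolding mat_vec_def
  by (simp add: fun_eq_iff distrib_right infsum_add mat_vec_summable[OF assms(1,3)]
      mat_vec_summable[OF assms(2,3)])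

lemma mat_vec_scale: "mat_vec G (mat_scale c A) x = (\<lambda>i. c * mat_vec G A x i)"
  by (simp add: mat_vec_def mat_scale_def mult.assoc infsum_cmult_right')

lemma mat_vec_one:
  assumes "x \<in> ell2 G"
  shows "mat_vec G (mat_one G) x = x"
proof
  fix i
  show "mat_vec G (mat_one G) x i = x i"
  proof (cases "i \<in> G")
    case True
    have "mat_vec G (mat_one G) x i = (\<Sum>\<^sub>\<infinity>j\<in>{i}. mat_one G i j * x j)"
      unfolding mat_vec_def by (rule infsum_cong_neutral) (use True in \<open>auto simp: mat_one_def\<close>)
    then show ?thesis
      using True by (simp add: mat_one_def)
  next
    case False
    then show ?thesis
      using assms by (simp add: mat_vec_def mat_one_def ell2_def)
  qed
qed

text \<open>Unit vectors recover the entries. Matrix identities such as associativity thus reduce to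
  composition of operators, with no interchange of double series.\<close>

lemma bounded_matrices_eqI:
  assumes "A \<in> bounded_matrices G" "B \<in> bounded_matrices G"
    and "\<And>x. x \<in> ell2 G \<Longrightarrow> mat_vec G A x = mat_vec G B x"
  shows "A = B"
proof -
  have "operator_matrix G (mat_vec G A) = operator_matrix G (mat_vec G B)"
    using assms(3) by (auto simp: operator_matrix_def fun_eq_iff unit_vec_in_ell2)
  then show ?thesis
    using assms by (simp add: operator_matrix_mat_vec)
qed

lemma mat_mult_assoc:
  assumes "A \<in> bounded_matrices G" "B \<in> bounded_matrices G" "C \<in> bounded_matrices G"
  shows "mat_mult G (mat_mult G A B) C = mat_mult G A (mat_mult G B C)"
  by (rule bounded_matrices_eqI[of _ G]) (use assms in \<open>simp_all add: mat_mult_bounded_matrices mat_vec_in_ell2\<close>)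

lemma mat_one_bounded: "mat_one G \<in> bounded_matrices G"
proof -
  have "bounded_operator G id"
    by (auto simp: bounded_operator_def intro: exI[of _ 1])
  then have "operator_matrix G id \<in> bounded_matrices G"
    by (rule operator_matrix_in_bounded_matrices)
  also have "operator_matrix G id = mat_one G"
    by (auto simp: operator_matrix_def mat_one_def unit_vec_def fun_eq_iff)
  finally show ?thesis .
qed

lemma mat_mult_one:
  assumes "A \<in> bounded_matrices G"
  shows mat_mult_one_left: "mat_mult G (mat_one G) A = A"
    and mat_mult_one_right: "mat_mult G A (mat_one G) = A"
  by (rule bounded_matrices_eqI[of _ G],
      use assms in \<open>simp_all add: mat_mult_bounded_matrices mat_vec_in_ell2 mat_one_bounded mat_vec_one\<close>)+

text \<open>The definition of boundedness leaves the sign of the constant open; a positive one is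
  needed later, where it occurs in a denominator.\<close>

lemma bounded_matrix_bound:
  assumes "A \<in> bounded_matrices G"
  obtains C where "0 < C" "\<And>x. x \<in> ell2 G \<Longrightarrow> ell2_norm G (mat_vec G A x) \<le> C * ell2_norm G x"
proof -
  obtain C where C: "\<And>x. x \<in> ell2 G \<Longrightarrow> ell2_norm G (mat_vec G A x) \<le> C * ell2_norm G x"
    using assms unfolding bounded_matrices_def bounded_operator_def by blast
  have "ell2_norm G (mat_vec G A x) \<le> (\<bar>C\<bar> + 1) * ell2_norm G x" if "x \<in> ell2 G" for x
    by (rule order_trans[OF C[OF that]]) (auto intro: mult_right_mono)
  then show ?thesis
    using that[of "\<bar>C\<bar> + 1"] by simp
qed

lemma mat_opnorm_upper:
  assumes A: "A \<in> bounded_matrices G" and x: "x \<in> ell2 G" "ell2_norm G x \<le> 1"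
  shows "ell2_norm G (mat_vec G A x) \<le> mat_opnorm G A"
proof -
  obtain C where C: "0 < C" "\<And>x. x \<in> ell2 G \<Longrightarrow> ell2_norm G (mat_vec G A x) \<le> C * ell2_norm G x"
    using bounded_matrix_bound[OF A] by blast
  have "ell2_norm G (mat_vec G A y) \<le> C" if "y \<in> ell2 G" "ell2_norm G y \<le> 1" for y
    using C(2)[OF that(1)] mult_left_mono[OF that(2), of C] C(1) by linarith
  then have "bdd_above ((\<lambda>x. ell2_norm G (mat_vec G A x)) ` {x \<in> ell2 G. ell2_norm G x \<le> 1})"
    by (intro bdd_aboveI2[where M = C]) auto
  then show ?thesis
    unfolding mat_opnorm_def operator_norm_def using x by (intro cSUP_upper) auto
qed

lemma mat_opnorm_nonneg:
  assumes "A \<in> bounded_matrices G"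
  shows "0 \<le> mat_opnorm G A"
  by (rule order_trans[OF _ mat_opnorm_upper[OF assms zero_in_ell2]]) auto

lemma mat_vec_le_mat_opnorm:
  assumes A: "A \<in> bounded_matrices G" and x: "x \<in> ell2 G"
  shows "ell2_norm G (mat_vec G A x) \<le> mat_opnorm G A * ell2_norm G x"
proof (cases "ell2_norm G x = 0")
  case True
  \<comment> \<open>A vector of norm 0 cannot be normalised, but any bound for \<open>A\<close>
    forces its image to have norm 0 too.\<close>
  obtain C where "ell2_norm G (mat_vec G A x) \<le> C * ell2_norm G x"
    using bounded_matrix_bound[OF A] x by metis
  with True show ?thesis by simp
next
  case False
  then have pos: "0 < ell2_norm G x"
    by (simp add: order_less_le)
  define c where "c = complex_of_real (1 / ell2_norm G x)"
  have c: "cmod c = 1 / ell2_norm G x"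
    using pos by (simp add: c_def norm_divide)
  have "ell2_norm G (mat_vec G A (\<lambda>i. c * x i)) \<le> mat_opnorm G A"
    using pos by (intro mat_opnorm_upper A ell2_add_scale x) (simp add: ell2_norm_scale c)
  then show ?thesis
    using pos by (simp add: mat_vec_scale_vec[OF A x] ell2_norm_scale c field_simps)
qed

lemma mat_opnorm_le:
  assumes "0 \<le> C" "\<And>x. x \<in> ell2 G \<Longrightarrow> ell2_norm G (mat_vec G A x) \<le> C * ell2_norm G x"
  shows "mat_opnorm G A \<le> C"
  unfolding mat_opnorm_def operator_norm_def
proof (rule cSUP_least)
  show "{x \<in> ell2 G. ell2_norm G x \<le> 1} \<noteq> {}"
    using zero_in_ell2[of G] by (auto intro!: exI[of _ "\<lambda>i. 0"])
  show "ell2_norm G (mat_vec G A x) \<le> C" if "x \<in> {x \<in> ell2 G. ell2_norm G x \<le> 1}" for x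
  proof -
    have "ell2_norm G (mat_vec G A x) \<le> C * ell2_norm G x"
      using assms(2) that by blast
    also have "\<dots> \<le> C * 1"
      using assms(1) that by (intro mult_left_mono) auto
    finally show ?thesis by simp
  qed
qed

text \<open>
  The interchange of the two summations is the expansion of a bounded functional in the standard
  basis; the functional is made an operator of rank one to apply \<open>bounded_operator_has_sum\<close>.
\<close>

lemma mat_adjoint_inner:
  assumes A: "A \<in> bounded_matrices G" and x: "x \<in> ell2 G" and y: "y \<in> ell2 G"
  shows "((\<lambda>j. cnj (mat_vec G (mat_adjoint A) y j) * x j)
           has_sum (\<Sum>\<^sub>\<infinity>i\<in>G. cnj (y i) * mat_vec G A x i)) G"
proof (cases "G = {}")
  case False
  \<comment> \<open>The rank-one operator \<open>T\<close> needs a coordinate \<open>g\<close> in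
    which to store the value of the functional \<open>f\<close>.\<close>
  then obtain g where g: "g \<in> G" by blast
  define f where "f z = (\<Sum>\<^sub>\<infinity>i\<in>G. cnj (y i) * mat_vec G A z i)" for z
  define T where "T z = (\<lambda>i. if i = g then f z else 0)" for z
  have f_add: "f (u + v) = f u + f v" if "u \<in> ell2 G" "v \<in> ell2 G" for u v
    unfolding f_def using that A y
    by (simp add: mat_vec_add_vec distrib_left infsum_add ell2_product_summable mat_vec_in_ell2)
  have f_scale: "f (\<lambda>i. c * u i) = c * f u" if "u \<in> ell2 G" for u c
    unfolding f_def mat_vec_scale_vec[OF A that] by (simp add: mult.left_commute infsum_cmult_right')
  have "bounded_operator G T"
    unfolding bounded_operator_def
  proof (intro conjI ballI allI)
    show "T z \<in> ell2 G" for z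
      by (rule finite_support_in_ell2[of "{g}"]) (use g in \<open>auto simp: T_def\<close>)
    show "T (u + v) = T u + T v" if "u \<in> ell2 G" "v \<in> ell2 G" for u v
      by (simp add: T_def fun_eq_iff f_add[OF that])
    show "T (\<lambda>i. c * u i) = (\<lambda>i. c * T u i)" if "u \<in> ell2 G" for u c
      by (simp add: T_def fun_eq_iff f_scale[OF that])
    show "\<exists>C. \<forall>z\<in>ell2 G. ell2_norm G (T z) \<le> C * ell2_norm G z"
    proof (intro exI ballI)
      fix z assume z: "z \<in> ell2 G"
      have "ell2_norm G (T z) = cmod (f z)"
        unfolding T_def by (rule ell2_norm_single[OF g])
      also have "\<dots> \<le> ell2_norm G y * ell2_norm G (mat_vec G A z)"
        unfolding f_def by (rule ell2_Cauchy_Schwarz[OF mat_vec_in_ell2[OF A z] y])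
      also have "\<dots> \<le> ell2_norm G y * (mat_opnorm G A * ell2_norm G z)"
        by (intro mult_left_mono mat_vec_le_mat_opnorm A z) auto
      finally show "ell2_norm G (T z) \<le> (ell2_norm G y * mat_opnorm G A) * ell2_norm G z"
        by (simp add: mult.assoc)
    qed
  qed
  then have "((\<lambda>j. T (unit_vec j) g * x j) has_sum f x) G"
    using bounded_operator_has_sum[OF _ x, of T g] by (simp add: T_def)
  also have "?this \<longleftrightarrow> ((\<lambda>j. cnj (mat_vec G (mat_adjoint A) y j) * x j) has_sum f x) G"
  proof (rule has_sum_cong_neutral)
    fix j assume "j \<in> G \<inter> G"
    \<comment> \<open>The coefficient of \<open>f\<close> at the \<open>j\<close>-th basis vector is
      the pairing of \<open>y\<close> with column \<open>j\<close> of \<open>A\<close>, that is, the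
      conjugate of entry \<open>j\<close> of the adjoint applied to \<open>y\<close>.\<close>
    then have "T (unit_vec j) g = (\<Sum>\<^sub>\<infinity>i\<in>G. cnj (y i) * A i j)"
      by (simp add: T_def f_def mat_vec_unit_vec)
    also have "\<dots> = cnj (mat_vec G (mat_adjoint A) y j)"
      by (simp add: mat_vec_def mat_adjoint_def mult.commute flip: infsum_cnj)
    finally show "T (unit_vec j) g * x j = cnj (mat_vec G (mat_adjoint A) y j) * x j"
      by simp
  qed (auto simp: T_def)
  finally show ?thesis
    by (simp add: f_def)
qed simp

section \<open>Matrix powers\<close>

text \<open>Multiplication on the function type is pointwise, so powers with respect to
  \<open>mat_mult G\<close> need their own recursion.\<close>

primrec mat_power :: "'i set \<Rightarrow> 'i cmatrix \<Rightarrow> nat \<Rightarrow> 'i cmatrix" where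
  "mat_power G A 0 = mat_one G"
| "mat_power G A (Suc n) = mat_mult G A (mat_power G A n)"

lemma mat_power_bounded: "A \<in> bounded_matrices G \<Longrightarrow> mat_power G A n \<in> bounded_matrices G"
  by (induction n) (auto simp: mat_one_bounded mat_mult_bounded_matrices)

lemma mat_power_add:
  assumes "A \<in> bounded_matrices G"
  shows "mat_power G A (m + n) = mat_mult G (mat_power G A m) (mat_power G A n)"
  by (induction m)
     (use assms in \<open>simp_all add: mat_mult_assoc mat_mult_one_left mat_power_bounded\<close>)

lemma mat_power_bound:
  assumes "A \<in> bounded_matrices G" "0 \<le> r"
    and "\<And>x. x \<in> ell2 G \<Longrightarrow> ell2_norm G (mat_vec G A x) \<le> r * ell2_norm G x"
  shows "mat_opnorm G (mat_power G A n) \<le> r ^ n"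
proof (rule mat_opnorm_le)
  fix x assume x: "x \<in> ell2 G"
  show "ell2_norm G (mat_vec G (mat_power G A n) x) \<le> r ^ n * ell2_norm G x"
  proof (induction n)
    case (Suc n)
    have "ell2_norm G (mat_vec G (mat_power G A (Suc n)) x)
        \<le> r * ell2_norm G (mat_vec G (mat_power G A n) x)"
      using assms x by (simp add: mat_mult_bounded_matrices mat_power_bounded mat_vec_in_ell2)
    also have "\<dots> \<le> r * (r ^ n * ell2_norm G x)"
      using Suc assms by (intro mult_left_mono)
    finally show ?case by simp
  qed (simp add: mat_vec_one x)
qed (use assms in auto)

section \<open>Arithmetic in the algebra\<close>

context proper_q_banach_subalgebra
begin

lemma bounded: "A \<in> \<A> \<Longrightarrow> A \<in> bounded_matrices G"
  using subset_bounded by blast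

lemma mat_power_mem: "A \<in> \<A> \<Longrightarrow> mat_power G A n \<in> \<A>"
  by (induction n) (auto simp: one_mem mult_mem)

lemma mat_vec_diff:
  assumes "A \<in> \<A>" "B \<in> \<A>" "x \<in> ell2 G"
  shows "mat_vec G (A - B) x = mat_vec G A x - mat_vec G B x"
  using mat_vec_add[of "A - B" G B x] assms by (simp add: bounded minus_mem)

lemma mat_mult_add_left:
  assumes "A \<in> \<A>" "B \<in> \<A>" "C \<in> \<A>"
  shows "mat_mult G (A + B) C = mat_mult G A C + mat_mult G B C"
  by (rule bounded_matrices_eqI[of _ G])
     (use assms in \<open>simp_all add: mat_mult_bounded_matrices bounded mat_vec_in_ell2 mult_mem add_mem mat_vec_add\<close>)

lemma mat_mult_diff_left:
  assumes "A \<in> \<A>" "B \<in> \<A>" "C \<in> \<A>"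
  shows "mat_mult G (A - B) C = mat_mult G A C - mat_mult G B C"
  using mat_mult_add_left[of "A - B" B C] assms by (simp add: minus_mem)

lemma mat_mult_one_minus:
  assumes A: "A \<in> \<A>" and B: "B \<in> \<A>"
  shows "mat_mult G A (mat_one G - B) = A - mat_mult G A B"
proof (rule bounded_matrices_eqI[of _ G])
  fix x assume x: "x \<in> ell2 G"
  have "mat_vec G A (x - mat_vec G B x) + mat_vec G A (mat_vec G B x) = mat_vec G A x"
    using mat_vec_add_vec[OF bounded[OF A] mat_vec_in_ell2[OF bounded[OF minus_mem[OF one_mem B]] x]
      mat_vec_in_ell2[OF bounded[OF B] x]] B x
    by (simp add: mat_vec_diff mat_vec_one one_mem)
  then show "mat_vec G (mat_mult G A (mat_one G - B)) x = mat_vec G (A - mat_mult G A B) x"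
    using A B x
    by (simp add: mat_mult_bounded_matrices bounded mat_vec_diff mat_vec_one one_mem mult_mem
        minus_mem eq_diff_eq)
qed (use A B in \<open>simp_all add: bounded mult_mem minus_mem one_mem\<close>)

text \<open>The triangle inequality is available for the \<open>q\<close>-th power of the norm, so
  submultiplicativity is put in the same form.\<close>

lemma nrm_powr_mult:
  obtains K where "0 < K"
    "\<And>A B. A \<in> \<A> \<Longrightarrow> B \<in> \<A> \<Longrightarrow> nrm (mat_mult G A B) powr q \<le> K * nrm A powr q * nrm B powr q"
proof -
  obtain K where K: "0 < K" "\<And>A B. A \<in> \<A> \<Longrightarrow> B \<in> \<A> \<Longrightarrow> nrm (mat_mult G A B) \<le> K * nrm A * nrm B"
    using nrm_mult by blast
  have "nrm (mat_mult G A B) powr q \<le> K powr q * nrm A powr q * nrm B powr q"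
    if "A \<in> \<A>" "B \<in> \<A>" for A B
  proof -
    have "nrm (mat_mult G A B) powr q \<le> (K * nrm A * nrm B) powr q"
      using K that q_pos by (intro powr_mono2 nrm_nonneg mult_mem) auto
    then show ?thesis
      using K that by (simp add: powr_mult nrm_nonneg)
  qed
  then show ?thesis
    using that[of "K powr q"] K by simp
qed

section \<open>Powers and Neumann series of a contraction\<close>

context
  fixes R r
  assumes R: "R \<in> \<A>" and r: "0 < r" "r < 1"
    and contract: "\<And>x. x \<in> ell2 G \<Longrightarrow> ell2_norm G (mat_vec G R x) \<le> r * ell2_norm G x"
begin

lemma mat_power_two_powers_tendsto_0:
  "(\<lambda>k. nrm (mat_power G R (2 ^ k)) powr q) \<longlonglongrightarrow> 0"
proof -
  obtain \<theta> D where \<theta>: "0 < \<theta>" "\<theta> \<le> 1" and D: "0 < D"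
    and diff: "\<And>A B. A \<in> \<A> \<Longrightarrow> B \<in> \<A> \<Longrightarrow> nrm (mat_mult G A B) powr q \<le>
      D * nrm A powr q * nrm B powr q *
        ((mat_opnorm G A / nrm A) powr (q * \<theta>) + (mat_opnorm G B / nrm B) powr (q * \<theta>))"
    using differential by blast
  show ?thesis
  \<comment> \<open>The recursion is used with \<open>\<tau> = r powr q\<close> and constant
    \<open>2 * D\<close>; the 2 arises because both factors of the product are the same matrix
    \<open>P\<close>.\<close>
  proof (rule squaring_recursion_tendsto_0)
    show "0 < r powr q" "r powr q < 1"
      using r q_pos powr_less_mono2[of q r 1] by auto
    show "0 < \<theta>" "\<theta> \<le> 1" "0 < 2 * D"
      using \<theta> D by auto
    fix k
    define P where "P = mat_power G R (2 ^ k)"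
    have P: "P \<in> \<A>"
      unfolding P_def by (rule mat_power_mem[OF R])
    have op: "mat_opnorm G P \<le> r ^ (2 ^ k)"
      unfolding P_def by (rule mat_power_bound) (use R r contract bounded in auto)
    have "mat_opnorm G P powr (q * \<theta>) \<le> (r ^ (2 ^ k)) powr (q * \<theta>)"
      using op P q_pos \<theta> by (intro powr_mono2) (auto simp: mat_opnorm_nonneg bounded)
    also have "\<dots> = (r powr q) powr (\<theta> * 2 ^ k)"
      using r by (simp add: powr_powr mult_ac flip: powr_realpow)
    finally have op_powr: "mat_opnorm G P powr (q * \<theta>) \<le> (r powr q) powr (\<theta> * 2 ^ k)" .
    have "nrm (mat_power G R (2 ^ Suc k)) powr q = nrm (mat_mult G P P) powr q"
      using mat_power_add[OF bounded[OF R], of "2 ^ k" "2 ^ k"] by (simp add: P_def mult_2)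
    also have "\<dots> \<le> D * nrm P powr q * nrm P powr q * (2 * (mat_opnorm G P / nrm P) powr (q * \<theta>))"
      using diff[OF P P] by simp
    \<comment> \<open>The denominator \<open>nrm P powr (q * \<theta>)\<close> lowers the exponent
      of \<open>nrm P powr q\<close> from 2 to \<open>2 - \<theta>\<close>. If
      \<open>nrm P = 0\<close>, both sides are 0.\<close>
    also have "\<dots> = 2 * D * (nrm P powr q) powr (2 - \<theta>) * mat_opnorm G P powr (q * \<theta>)"
    proof (cases "nrm P = 0")
      case False
      then have "0 < nrm P"
        using nrm_nonneg[OF P] by simp
      then have eq: "nrm P powr q * nrm P powr q / nrm P powr (q * \<theta>) = (nrm P powr q) powr (2 - \<theta>)"
        by (simp add: powr_powr right_diff_distrib powr_diff mult_2_right flip: powr_add)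
      then show ?thesis
        unfolding eq[symmetric] using \<open>0 < nrm P\<close> P
        by (simp add: powr_divide mat_opnorm_nonneg bounded mult_ac)
    qed simp
    also have "\<dots> \<le> 2 * D * (nrm P powr q) powr (2 - \<theta>) * (r powr q) powr (\<theta> * 2 ^ k)"
      using op_powr D by (intro mult_left_mono) auto
    finally show "nrm (mat_power G R (2 ^ Suc k)) powr q
        \<le> 2 * D * (nrm (mat_power G R (2 ^ k)) powr q) powr (2 - \<theta>) * (r powr q) powr (\<theta> * 2 ^ k)"
      by (simp add: P_def)
  qed auto
qed

text \<open>A power of \<open>R\<close> whose \<open>q\<close>-th norm power is below
  \<open>1 / K\<close> acts as a contraction: multiplying by it shifts the exponent by
  \<open>2 ^ k\<close> and costs a factor below 1.\<close>

lemma mat_power_summable: "summable (\<lambda>n. nrm (mat_power G R n) powr q)"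
proof -
  obtain K where K: "0 < K"
    "\<And>A B. A \<in> \<A> \<Longrightarrow> B \<in> \<A> \<Longrightarrow> nrm (mat_mult G A B) powr q \<le> K * nrm A powr q * nrm B powr q"
    using nrm_powr_mult by blast
  have "\<forall>\<^sub>F k in sequentially. nrm (mat_power G R (2 ^ k)) powr q < 1 / K"
    using mat_power_two_powers_tendsto_0 K by (intro order_tendstoD) auto
  then obtain k where k: "nrm (mat_power G R (2 ^ k)) powr q < 1 / K"
    by (auto simp: eventually_sequentially)
  show ?thesis
  proof (rule summable_if_shift_contracts)
    show "K * nrm (mat_power G R (2 ^ k)) powr q < 1"
      using k K by (simp add: field_simps)
    show "nrm (mat_power G R (n + 2 ^ k)) powr q
        \<le> K * nrm (mat_power G R (2 ^ k)) powr q * nrm (mat_power G R n) powr q" for n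
      using K(2)[of "mat_power G R (2 ^ k)" "mat_power G R n"] R
      by (simp add: mat_power_mem mat_power_add bounded add.commute[of n])
  qed auto
qed

lemma left_inverse_one_minus:
  obtains S where "S \<in> \<A>" "mat_mult G S (mat_one G - R) = mat_one G"
proof -
  define \<sigma> where "\<sigma> n = (\<Sum>k<n. mat_power G R k)" for n
  have \<sigma>_0: "\<sigma> 0 = 0" and \<sigma>_Suc: "\<sigma> (Suc n) = \<sigma> n + mat_power G R n" for n
    by (simp_all add: \<sigma>_def)
  have \<sigma>: "\<sigma> n \<in> \<A>" for n
    by (induction n) (simp_all only: \<sigma>_0 \<sigma>_Suc zero_mem add_mem mat_power_mem R)
  have "qdist (\<sigma> n) (\<sigma> (Suc n)) = nrm (mat_power G R n) powr q" for n
    using \<sigma>[of n] \<sigma>[of "Suc n"] nrm_minus_commute[OF \<sigma>[of n] \<sigma>[of "Suc n"]]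
    by (simp add: qdist_def \<sigma>_Suc)
  \<comment> \<open>Consecutive partial sums differ by one power of \<open>R\<close>, so their
    distances are exactly the summable terms.\<close>
  then have "MCauchy \<sigma>"
    using mat_power_summable \<sigma> by (intro MCauchy_if_summable) auto
  then obtain S where S: "limitin mtopology \<sigma> S sequentially"
    using complete unfolding mcomplete_def by blast
  then have S_mem: "S \<in> \<A>" and lim: "(\<lambda>n. qdist (\<sigma> n) S) \<longlonglongrightarrow> 0"
    by (auto simp: limitin_metric_dist_null)
  define T where "T = mat_one G - R"
  have T: "T \<in> \<A>"
    by (simp add: T_def minus_mem one_mem R)
  have telescope: "mat_mult G (\<sigma> n) T = mat_one G - mat_power G R n" for n
  proof (induction n)
    case 0
    then show ?case
      by (simp add: \<sigma>_0 mat_mult_def fun_eq_iff)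
  next
    case (Suc n)
    have "mat_mult G (mat_power G R n) R = mat_power G R (Suc n)"
      using mat_power_add[OF bounded[OF R], of n 1] R by (simp add: mat_mult_one_right bounded)
    then have "mat_mult G (mat_power G R n) T = mat_power G R n - mat_power G R (Suc n)"
      unfolding T_def by (simp only: mat_mult_one_minus mat_power_mem R)
    moreover have "mat_mult G (\<sigma> (Suc n)) T = mat_mult G (\<sigma> n) T + mat_mult G (mat_power G R n) T"
      using mat_mult_add_left[OF \<sigma> mat_power_mem[OF R] T] by (simp only: \<sigma>_Suc)
    ultimately show ?case
      using Suc by simp
  qed
  obtain K where K: "0 < K"
    "\<And>A B. A \<in> \<A> \<Longrightarrow> B \<in> \<A> \<Longrightarrow> nrm (mat_mult G A B) powr q \<le> K * nrm A powr q * nrm B powr q"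
    using nrm_powr_mult by blast
  \<comment> \<open>The error splits into replacing \<open>S\<close> by \<open>\<sigma> n\<close>
    and the telescoping remainder \<open>mat_power G R n\<close>. Both tend to 0, while the left
    side does not depend on \<open>n\<close>.\<close>
  have est: "nrm (mat_mult G S T - mat_one G) powr q
      \<le> K * qdist (\<sigma> n) S * nrm T powr q + nrm (mat_power G R n) powr q" for n
  proof -
    have "mat_mult G S T - mat_one G = mat_mult G (S - \<sigma> n) T + (mat_mult G (\<sigma> n) T - mat_one G)"
      using S_mem \<sigma> T by (simp add: mat_mult_diff_left)
    then have "nrm (mat_mult G S T - mat_one G) powr q
        \<le> nrm (mat_mult G (S - \<sigma> n) T) powr q + nrm (mat_mult G (\<sigma> n) T - mat_one G) powr q"
      using S_mem \<sigma> T by (simp only: nrm_add mult_mem minus_mem one_mem)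
    also have "nrm (mat_mult G (\<sigma> n) T - mat_one G) = nrm (mat_power G R n)"
      using nrm_minus_commute[OF mult_mem[OF \<sigma>[of n] T] one_mem] by (simp add: telescope)
    also have "nrm (mat_mult G (S - \<sigma> n) T) powr q \<le> K * nrm (S - \<sigma> n) powr q * nrm T powr q"
      using S_mem \<sigma> T by (intro K(2) minus_mem)
    also have "nrm (S - \<sigma> n) powr q = qdist (\<sigma> n) S"
      using S_mem \<sigma>[of n] nrm_minus_commute[OF S_mem \<sigma>[of n]] by (simp add: qdist_def)
    finally show ?thesis
      by this (rule add_right_mono)
  qed
  have "(\<lambda>n. K * qdist (\<sigma> n) S * nrm T powr q + nrm (mat_power G R n) powr q)
      \<longlonglongrightarrow> K * 0 * nrm T powr q + 0"
    by (intro tendsto_intros lim summable_LIMSEQ_zero mat_power_summable)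
  then have "nrm (mat_mult G S T - mat_one G) powr q \<le> K * 0 * nrm T powr q + 0"
    by (rule LIMSEQ_le_const) (use est in blast)
  then have "nrm (mat_mult G S T - mat_one G) = 0"
    using q_pos by simp
  then have "mat_mult G S T = mat_one G"
    using nrm_eq_0_iff[OF minus_mem[OF mult_mem[OF S_mem T] one_mem]] by simp
  then show ?thesis
    using that[OF S_mem] by (simp add: T_def)
qed

end

section \<open>Contraction from the Gram matrix, and inverse-closedness\<close>

text \<open>
  The constant \<open>c\<close> uses the norm of \<open>\<A>\<close> instead of the operator norm: by (P1) and (P2) it bounds
  both \<open>A\<close> and its adjoint, so that the operator norm of the adjoint need not be computed.
\<close>

lemma one_minus_gram_contracts:
  assumes A: "A \<in> \<A>" and pos: "0 < nrm A"
    and B: "B \<in> bounded_matrices G" and BA: "mat_mult G B A = mat_one G"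
    and c: "c = 1 / (nrm A)\<^sup>2"
  obtains r where "0 < r" "r < 1"
    "\<And>x. x \<in> ell2 G \<Longrightarrow>
      ell2_norm G (mat_vec G (mat_one G - mat_scale (of_real c) (mat_mult G (mat_adjoint A) A)) x)
        \<le> r * ell2_norm G x"
proof -
  define R where "R = mat_one G - mat_scale (of_real c) (mat_mult G (mat_adjoint A) A)"
  have A': "mat_adjoint A \<in> \<A>"
    by (rule adjoint_mem[OF A])
  obtain b where b: "0 < b" "\<And>x. x \<in> ell2 G \<Longrightarrow> ell2_norm G (mat_vec G B x) \<le> b * ell2_norm G x"
    using bounded_matrix_bound[OF B] by blast
  have c_pos: "0 < c"
    using pos by (simp add: c)
  \<comment> \<open>The lower bound \<open>1 / 2\<close> keeps \<open>r\<close> positive even when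
    \<open>1 - c / b\<^sup>2\<close> is not.\<close>
  define r where "r = sqrt (max (1 / 2) (1 - c / b\<^sup>2))"
  have r: "0 < r" "r < 1" and r_sq: "1 - c / b\<^sup>2 \<le> r\<^sup>2"
    using c_pos b by (auto simp: r_def less_max_iff_disj real_sqrt_lt_1_iff)
  have "ell2_norm G (mat_vec G R x) \<le> r * ell2_norm G x" if x: "x \<in> ell2 G" for x
  proof -
    define y where "y = mat_vec G A x"
    define z where "z = mat_vec G (mat_adjoint A) y"
    have y: "y \<in> ell2 G"
      unfolding y_def by (rule mat_vec_in_ell2[OF bounded[OF A] x])
    have z: "z \<in> ell2 G"
      unfolding z_def by (rule mat_vec_in_ell2[OF bounded[OF A'] y])
    have "R \<in> \<A>"
      by (simp add: R_def A A' one_mem minus_mem scale_mem mult_mem)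
    then have Rx_mem: "mat_vec G R x \<in> ell2 G"
      using x by (intro mat_vec_in_ell2 bounded)
    have Rx: "mat_vec G R x i = x i - of_real c * z i" for i
      using A A' x
      by (simp add: R_def mat_vec_diff one_mem scale_mem mult_mem mat_vec_one mat_vec_scale
          mat_mult_bounded_matrices bounded z_def y_def)
    \<comment> \<open>This is the identity that pairing \<open>A\<^sup>* A x\<close> with
      \<open>x\<close> gives the squared norm of \<open>A x\<close>; it evaluates the cross term in
      the square of \<open>x - c z\<close>.\<close>
    have inner: "((\<lambda>j. Re (cnj (z j) * x j)) has_sum (ell2_norm G y)\<^sup>2) G"
    proof -
      have "((\<lambda>i. of_real ((cmod (y i))\<^sup>2)) has_sum (of_real ((ell2_norm G y)\<^sup>2) :: complex)) G"
        by (intro has_sum_of_real ell2_norm_has_sum y)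
      moreover have "cnj (y i) * mat_vec G A x i = of_real ((cmod (y i))\<^sup>2)" for i
        unfolding complex_norm_square by (simp add: y_def)
      ultimately have "(\<Sum>\<^sub>\<infinity>i\<in>G. cnj (y i) * mat_vec G A x i) = of_real ((ell2_norm G y)\<^sup>2)"
        by (simp add: infsumI)
      then show ?thesis
        using has_sum_Re[OF mat_adjoint_inner[OF bounded[OF A] x y]] by (simp add: z_def)
    qed
    have "((\<lambda>i. (cmod (x i))\<^sup>2 + (- 2 * c * Re (cnj (z i) * x i) + c\<^sup>2 * (cmod (z i))\<^sup>2)) has_sum
        ((ell2_norm G x)\<^sup>2 + (- 2 * c * (ell2_norm G y)\<^sup>2 + c\<^sup>2 * (ell2_norm G z)\<^sup>2))) G"
      by (intro has_sum_add has_sum_cmult_right ell2_norm_has_sum x z inner)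
    also have "(\<lambda>i. (cmod (x i))\<^sup>2 + (- 2 * c * Re (cnj (z i) * x i) + c\<^sup>2 * (cmod (z i))\<^sup>2))
        = (\<lambda>i. (cmod (mat_vec G R x i))\<^sup>2)"
      unfolding Rx cmod_power2 by (simp add: fun_eq_iff power2_eq_square algebra_simps)
    finally have Rx_norm: "(ell2_norm G (mat_vec G R x))\<^sup>2
        = (ell2_norm G x)\<^sup>2 + (- 2 * c * (ell2_norm G y)\<^sup>2 + c\<^sup>2 * (ell2_norm G z)\<^sup>2)"
      using ell2_norm_has_sum[OF Rx_mem] by (simp add: has_sum_unique)
    have "ell2_norm G z \<le> mat_opnorm G (mat_adjoint A) * ell2_norm G y"
      unfolding z_def by (rule mat_vec_le_mat_opnorm[OF bounded[OF A'] y])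
    also have "\<dots> \<le> nrm A * ell2_norm G y"
      using opnorm_le_nrm[OF A'] nrm_adjoint[OF A] by (intro mult_right_mono) auto
    finally have "(ell2_norm G z)\<^sup>2 \<le> (nrm A)\<^sup>2 * (ell2_norm G y)\<^sup>2"
      by (simp add: power_mono flip: power_mult_distrib)
    then have "c\<^sup>2 * (ell2_norm G z)\<^sup>2 \<le> c\<^sup>2 * ((nrm A)\<^sup>2 * (ell2_norm G y)\<^sup>2)"
      by (intro mult_left_mono) auto
    also have "\<dots> = c * (ell2_norm G y)\<^sup>2"
      using pos by (simp add: c power2_eq_square)
    \<comment> \<open>With \<open>c = 1 / (nrm A)\<^sup>2\<close> the quadratic term costs at most
      half of the gain \<open>2 * c * (ell2_norm G y)\<^sup>2\<close> from the cross term.\<close>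
    finally have z_le: "c\<^sup>2 * (ell2_norm G z)\<^sup>2 \<le> c * (ell2_norm G y)\<^sup>2" .
    \<comment> \<open>The left inverse \<open>B\<close> bounds \<open>A\<close> from below, so the
      remaining gain is a fixed fraction of the squared norm of \<open>x\<close>.\<close>
    have "mat_vec G B y = x"
      using mat_mult_bounded_matrices(2)[OF B bounded[OF A] x] by (simp add: BA mat_vec_one x y_def)
    then have "(ell2_norm G x)\<^sup>2 \<le> (b * ell2_norm G y)\<^sup>2"
      using b(2)[OF y] by (intro power_mono) auto
    then have "c / b\<^sup>2 * (ell2_norm G x)\<^sup>2 \<le> c / b\<^sup>2 * (b * ell2_norm G y)\<^sup>2"
      using c_pos by (intro mult_left_mono) auto
    also have "\<dots> = c * (ell2_norm G y)\<^sup>2"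
      using b(1) by (simp add: power_mult_distrib)
    finally have "(ell2_norm G (mat_vec G R x))\<^sup>2 \<le> (1 - c / b\<^sup>2) * (ell2_norm G x)\<^sup>2"
      using Rx_norm z_le by (simp add: algebra_simps)
    also have "\<dots> \<le> (r * ell2_norm G x)\<^sup>2"
      unfolding power_mult_distrib by (intro mult_right_mono r_sq) auto
    finally show ?thesis
      using r by (simp add: power2_le_iff_abs_le)
  qed
  then show ?thesis
    using that[OF r] by (simp add: R_def)
qed

lemma inverse_mem:
  assumes A: "A \<in> \<A>" and B: "B \<in> bounded_matrices G"
    and AB: "mat_mult G A B = mat_one G" and BA: "mat_mult G B A = mat_one G"
  shows "B \<in> \<A>"
proof (cases "nrm A = 0")
  case True
  \<comment> \<open>Here \<open>c\<close> would divide by 0. But \<open>A = 0\<close> makes the unit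
    vanish, and with it \<open>B\<close>.\<close>
  then have "mat_one G = 0"
    using A AB by (simp add: nrm_eq_0_iff mat_mult_def fun_eq_iff)
  then have "B = 0"
    using mat_mult_one_left[OF B] by (simp add: mat_mult_def fun_eq_iff)
  then show ?thesis
    using zero_mem by simp
next
  case False
  then have pos: "0 < nrm A"
    using nrm_nonneg[OF A] by simp
  define c where "c = 1 / (nrm A)\<^sup>2"
  define A' where "A' = mat_adjoint A"
  have A': "A' \<in> \<A>"
    unfolding A'_def by (rule adjoint_mem[OF A])
  define H where "H = mat_scale (of_real c) (mat_mult G A' A)"
  have H: "H \<in> \<A>"
    by (simp add: H_def scale_mem mult_mem A A')
  obtain r where "0 < r" "r < 1"
    "\<And>x. x \<in> ell2 G \<Longrightarrow> ell2_norm G (mat_vec G (mat_one G - H) x) \<le> r * ell2_norm G x"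
    using one_minus_gram_contracts[OF A pos B BA c_def] unfolding H_def A'_def by blast
  \<comment> \<open>Since \<open>mat_one G - (mat_one G - H)\<close> is \<open>H\<close>, this
    \<open>S\<close> is a left inverse of \<open>H\<close>.\<close>
  then obtain S where S: "S \<in> \<A>" "mat_mult G S (mat_one G - (mat_one G - H)) = mat_one G"
    using left_inverse_one_minus[of "mat_one G - H" r] by (auto simp: minus_mem one_mem H)
  define L where "L = mat_scale (of_real c) (mat_mult G S A')"
  have L: "L \<in> \<A>"
    by (simp add: L_def scale_mem mult_mem S A')
  have "mat_mult G L A = mat_scale (of_real c) (mat_mult G (mat_mult G S A') A)"
    by (simp add: L_def mat_mult_def mat_scale_def mult.assoc infsum_cmult_right')
  also have "\<dots> = mat_scale (of_real c) (mat_mult G S (mat_mult G A' A))"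
    using S A A' by (simp add: mat_mult_assoc bounded)
  also have "\<dots> = mat_mult G S H"
    by (simp add: H_def mat_mult_def mat_scale_def mult.left_commute infsum_cmult_right')
  also have "\<dots> = mat_one G"
    using S by simp
  \<comment> \<open>A left inverse \<open>L\<close> of \<open>A\<close> inside the algebra must
    equal the right inverse \<open>B\<close>, by associativity.\<close>
  finally have "B = mat_mult G (mat_mult G L A) B"
    by (simp add: mat_mult_one_left B)
  also have "\<dots> = L"
    using L A B by (simp add: mat_mult_assoc bounded AB mat_mult_one_right)
  finally show ?thesis
    using L by simp
qed

end

theorem theorem6p2:
  fixes G :: "(int ^ 'd::finite) set"
    and q :: real
    and \<A> :: "(int ^ 'd) cmatrix set"
    and nrm :: "(int ^ 'd) cmatrix \<Rightarrow> real"
  assumes "0 < q" and "q \<le> 1"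
    and "proper_q_banach_subalgebra G q \<A> nrm"
  shows "inverse_closed G \<A>"
proof -
  interpret proper_q_banach_subalgebra G q \<A> nrm
    by (rule assms(3))
  show ?thesis
    using inverse_mem by (auto simp: inverse_closed_def)
qed

end
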